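(* Let $n\geq 4$ be finite. There is no linear orthoset of rank $n$ that embeds into every other linear orthoset of rank $n$.
   Context: An orthoset is a set $X$ with a symmetric, irreflexive binary relation $\perp$. Its rank is the supremum of the cardinalities of subsets consisting of mutually orthogonal elements. For $A\subseteq X$, $A^\perp=\{e\in X: e\perp f \text{ for all } f\in A\}$. $(X,\perp)$ is linear if for any distinct $e,f\in X$ there is a $g\in X$ such that exactly one of $f$ and $g$ is orthogonal to $e$ and $\{e,f\}^\perp=\{e,g\}^\perp$. An embedding of orthosets is an injective map $\varphi$ with $e\perp f\Leftrightarrow\varphi(e)\perp\varphi(f)$; $X$ embeds into $Y$ if there is an embedding $X\to Y$. *)

theory Defs
  imports Main "HOL-Library.Extended_Nat" "HOL-Library.Infinite_Typeclass"
begin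

text \<open>An orthoset is given by a carrier set together with a relation on the ambient type; only
  the restriction of the relation to the carrier matters.\<close>

locale orthoset =
  fixes X :: "'a set" and perp :: "'a \<Rightarrow> 'a \<Rightarrow> bool"
  assumes perp_sym: "symp_on X perp"
    and perp_irrefl: "irreflp_on X perp"

definition orthocompl :: "'a set \<Rightarrow> ('a \<Rightarrow> 'a \<Rightarrow> bool) \<Rightarrow> 'a set \<Rightarrow> 'a set" where
  "orthocompl X perp A = {e \<in> X. \<forall>f\<in>A. perp e f}"

locale linear_orthoset = orthoset +
  assumes linear: "\<lbrakk>e \<in> X; f \<in> X; e \<noteq> f\<rbrakk> \<Longrightarrow>
    \<exists>g\<in>X. (perp f e \<longleftrightarrow> \<not> perp g e) \<and> orthocompl X perp {e, f} = orthocompl X perp {e, g}"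

definition ecard :: "'a set \<Rightarrow> enat" where
  "ecard A = (if finite A then enat (card A) else \<infinity>)"

text \<open>All infinite cardinalities are identified with \<open>\<infinity>\<close>, which makes no difference to the
  assertion that the rank is a given natural number.\<close>

definition orthoset_rank :: "'a set \<Rightarrow> ('a \<Rightarrow> 'a \<Rightarrow> bool) \<Rightarrow> enat" where
  "orthoset_rank X perp = (SUP A \<in> {A. A \<subseteq> X \<and> pairwise perp A}. ecard A)"

definition orthoset_embedding ::
    "'a set \<Rightarrow> ('a \<Rightarrow> 'a \<Rightarrow> bool) \<Rightarrow> 'b set \<Rightarrow> ('b \<Rightarrow> 'b \<Rightarrow> bool) \<Rightarrow> ('a \<Rightarrow> 'b) \<Rightarrow> bool" where
  "orthoset_embedding X perp Y perp' \<phi> \<longleftrightarrow>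
    \<phi> ` X \<subseteq> Y \<and> inj_on \<phi> X \<and> (\<forall>e\<in>X. \<forall>f\<in>X. perp e f \<longleftrightarrow> perp' (\<phi> e) (\<phi> f))"

definition orthoset_embeds ::
    "'a set \<Rightarrow> ('a \<Rightarrow> 'a \<Rightarrow> bool) \<Rightarrow> 'b set \<Rightarrow> ('b \<Rightarrow> 'b \<Rightarrow> bool) \<Rightarrow> bool" where
  "orthoset_embeds X perp Y perp' \<longleftrightarrow> (\<exists>\<phi>. orthoset_embedding X perp Y perp' \<phi>)"

text \<open>By reflexivity, embedding into every linear orthoset of a given rank is the same as
  embedding into every other one.\<close>

lemma orthoset_embeds_refl: "orthoset_embeds X perp X perp"
  unfolding orthoset_embeds_def orthoset_embedding_def by (rule exI[of _ id]) simp

text \<open>HOL cannot quantify over the carrier types of all orthosets inside a formula. In a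
  non-existence claim of the form ``no \<open>X\<close> embeds into every \<open>Y\<close>'', let \<open>X\<close> live in an arbitrary
  type \<open>'a\<close> and let \<open>Y\<close> range over the orthosets in an arbitrary infinite type \<open>'b\<close>, possibly
  unrelated to \<open>'a\<close>. Restricting the \<open>Y\<close> to one type only strengthens the claim. Infinitude of
  \<open>'b\<close> ensures that there is room for the countably infinite orthosets; over a type \<open>'b\<close> without
  any linear orthoset of the given rank, every \<open>X\<close> would vacuously embed into all \<open>Y\<close>.\<close>

end

theory Submission
  imports Defs "HOL-Library.Poly_Mapping" "HOL-Library.Z2" "HOL-Library.Countable_Set"
begin

text \<open>Choose collinear points \<open>p\<close>, \<open>q\<close>, \<open>m\<close> on the three sides of a triangle. By the theorems of
  Menelaus and Ceva, the three cevians through these points are concurrent if and only if \<open>2 = 0\<close>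
  holds for the scalars. Every linear orthoset of finite rank at least 3 contains such a
  configuration, expressed in terms of orthogonality alone, and orthogonality together with its
  negation is preserved by embeddings. Hence no such orthoset embeds, within the
  same rank, both into the projective space of an
  anisotropic form over the integers and into that of an anisotropic form in characteristic 2.\<close>

section \<open>Orthogonal bases of linear orthosets\<close>

context linear_orthoset
begin

abbreviation compl :: "'a set \<Rightarrow> 'a set" where "compl \<equiv> orthocompl X perp"

lemma perp_symD: "x \<in> X \<Longrightarrow> y \<in> X \<Longrightarrow> perp x y \<Longrightarrow> perp y x"
  using perp_sym by (auto dest: symp_onD)

lemma perp_irreflD: "x \<in> X \<Longrightarrow> \<not> perp x x"
  using perp_irrefl by (auto dest: irreflp_onD)

lemma compl_insert: "compl (insert a A) = {x \<in> compl A. perp x a}"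
  by (auto simp: orthocompl_def)

lemma compl_Un: "compl (A \<union> B) = compl A \<inter> compl B"
  by (auto simp: orthocompl_def)

lemma in_complI: "\<lbrakk>x \<in> X; \<And>a. a \<in> A \<Longrightarrow> perp x a\<rbrakk> \<Longrightarrow> x \<in> compl A"
  by (auto simp: orthocompl_def)

lemma in_complD: "x \<in> compl A \<Longrightarrow> x \<in> X" "x \<in> compl A \<Longrightarrow> a \<in> A \<Longrightarrow> perp x a"
  by (auto simp: orthocompl_def)

lemma pairwise_insertI:
  "\<lbrakk>A \<subseteq> X; pairwise perp A; x \<in> compl A\<rbrakk> \<Longrightarrow> pairwise perp (insert x A)"
  using perp_symD[of x] by (auto simp: pairwise_insert orthocompl_def subset_iff)

lemma compl_notin: "x \<in> compl A \<Longrightarrow> x \<notin> A"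
  using perp_irreflD by (auto simp: orthocompl_def)

section \<open>Exchange of orthogonal bases of a subspace\<close>

lemma orthogonalize:
  assumes "e \<in> X" "f \<in> X" "e \<noteq> f"
  obtains g where "g \<in> X" "perp g e" "compl {e, f} = compl {e, g}"
proof (cases "perp f e")
  case True
  then show ?thesis using that assms by blast
next
  case False
  then show ?thesis using linear[OF assms] that by blast
qed

text \<open>As \<open>g\<close> lies on the line through \<open>e\<close> and \<open>f\<close>, it
  stays in every subspace \<open>compl A\<close> that contains both.\<close>

lemma compl_pair_transfer:
  assumes "A \<subseteq> X" "A \<subseteq> compl {e, f}" "compl {e, f} = compl {e, g}" "g \<in> X"
  shows "g \<in> compl A"
proof (rule in_complI)
  fix a assume a: "a \<in> A"
  then have "a \<in> compl {e, g}" using assms by blast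
  then show "perp g a" using perp_symD[of a g] a assms(1,4) by (auto simp: orthocompl_def)
qed fact

lemma subset_compl_pairI:
  assumes "A \<subseteq> X" "e \<in> compl A" "f \<in> compl A"
  shows "A \<subseteq> compl {e, f}"
proof
  fix a assume a: "a \<in> A"
  then show "a \<in> compl {e, f}"
    using assms perp_symD[of e a] perp_symD[of f a] by (simp add: orthocompl_def subset_iff)
qed

text \<open>The condition \<open>\<forall>x \<in> compl A. perp x b\<close> says that \<open>b\<close> lies in the biorthogonal of \<open>A\<close>, the
  subspace spanned by \<open>A\<close>.\<close>

lemma closure_drop:
  assumes "A \<subseteq> X" "a \<in> compl A" "b \<in> X" "perp b a"
    and cl: "\<forall>x \<in> compl (insert a A). perp x b" and x: "x \<in> compl A"
  shows "perp x b"
proof (cases "x = a")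
  case True
  then show ?thesis using assms(3,4) perp_symD[of b a] in_complD(1)[OF x] by blast
next
  case False
  have X: "x \<in> X" "a \<in> X" using assms in_complD by auto
  \<comment> \<open>This \<open>g\<close> is orthogonal to all of \<open>insert a A\<close>, hence
    to \<open>b\<close>. So \<open>b\<close> is orthogonal to \<open>a\<close> and \<open>g\<close>,
    and thereby to \<open>x\<close> on their line.\<close>
  obtain g where g: "g \<in> X" "perp g a" "compl {a, x} = compl {a, g}"
    using orthogonalize[OF X(2,1)] False by metis
  have "A \<subseteq> compl {a, x}"
    by (rule subset_compl_pairI) (use assms in blast)+
  then have "g \<in> compl A" using compl_pair_transfer g assms by blast
  then have "g \<in> compl (insert a A)" using g by (simp add: compl_insert)
  then have "b \<in> compl {a, g}" 
    using cl perp_symD[of g b] assms(3,4) g(1) by (simp add: orthocompl_def)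
  then have "b \<in> compl {a, x}" using g by simp
  then show ?thesis using perp_symD[of b x] X(1) by (simp add: orthocompl_def)
qed

text \<open>Steinitz exchange: equal orthocomplements mean equal spans. An element oblique to
  \<open>a\<close> enters the basis by rotating an orthogonal pair within its line through
  \<open>a\<close>.\<close>

lemma exchange:
  assumes "finite A" "A \<subseteq> X" "pairwise perp A" "b \<in> X" "\<forall>x \<in> compl A. perp x b"
  obtains A' where "A' \<subseteq> X" "finite A'" "pairwise perp A'" "b \<in> A'" "card A' = card A"
    "compl A' = compl A"
proof -
  have "\<exists>A'. A' \<subseteq> X \<and> finite A' \<and> pairwise perp A' \<and> b \<in> A' \<and> card A' = card A \<and> compl A' = compl A"
    using assms
  proof (induction A arbitrary: b rule: finite_induct)
    case empty
    then have "perp b b" by (auto simp: orthocompl_def)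
    then show ?case using perp_irreflD empty by blast
  next
    case (insert a A)
    have AX: "A \<subseteq> X" "a \<in> X" "pairwise perp A" and aA: "a \<in> compl A"
      using insert.prems insert.hyps by (auto simp: orthocompl_def pairwise_insert)
    \<comment> \<open>By \<open>closure_drop\<close>, such a \<open>c\<close> already lies in the
      span of \<open>A\<close>, so the induction hypothesis applies and \<open>a\<close> can be
      kept.\<close>
    have extend: "\<exists>A'. A' \<subseteq> X \<and> finite A' \<and> pairwise perp (insert a A') \<and> c \<in> A' \<and> a \<notin> A' \<and>
        card A' = card A \<and> compl A' = compl A"
      if c: "c \<in> X" "perp c a" "\<forall>x \<in> compl (insert a A). perp x c" for c
    proof -
      have "\<forall>x \<in> compl A. perp x c"
        using closure_drop[OF AX(1) aA c(1,2,3)] by blast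
      then obtain A' where A': "A' \<subseteq> X" "finite A'" "pairwise perp A'" "c \<in> A'"
          "card A' = card A" "compl A' = compl A"
        using insert.IH[OF AX(1,3) c(1)] by blast
      then show ?thesis using aA pairwise_insertI compl_notin by metis
    qed
    consider "b = a" | "perp b a" | "b \<noteq> a" "\<not> perp b a" by blast
    then show ?case
    proof cases
      case 1
      then show ?thesis using insert.prems insert.hyps by (intro exI[of _ "insert a A"]) auto
    next
      case 2
      then obtain A' where A': "A' \<subseteq> X" "finite A'" "pairwise perp (insert a A')" "b \<in> A'" "a \<notin> A'"
          "card A' = card A" "compl A' = compl A"
        using extend[OF insert.prems(3) 2 insert.prems(4)] by blast
      then show ?thesis using insert.hyps AX
        by (intro exI[of _ "insert a A'"]) (auto simp: compl_insert)
    next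
      case 3
      obtain g where g: "g \<in> X" "perp g a" "compl {a, b} = compl {a, g}"
        using orthogonalize[OF AX(2) insert.prems(3)] 3 by metis
      have "\<forall>x \<in> compl (insert a A). perp x g"
      proof
        fix x assume "x \<in> compl (insert a A)"
        then have "x \<in> compl {a, b}" using insert.prems by (auto simp: orthocompl_def)
        then show "perp x g" using g by (auto simp: orthocompl_def)
      qed
      then obtain A' where A': "A' \<subseteq> X" "finite A'" "pairwise perp (insert a A')" "g \<in> A'" "a \<notin> A'"
          "card A' = card A" "compl A' = compl A"
        using extend[OF g(1,2)] by blast
      define R where "R = A' - {g}"
      have RX: "R \<subseteq> X" "finite R" "g \<notin> R" and A'R: "A' = insert g R" and "a \<notin> R"
        using A' by (auto simp: R_def)
      have pR: "pairwise perp R" using A' by (auto simp: R_def pairwise_def)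
      \<comment> \<open>The orthogonal pair \<open>a\<close>, \<open>g\<close> is traded for
        \<open>b\<close>, \<open>h\<close>, which spans the same line; the rest \<open>R\<close>
        stays.\<close>
      obtain h where h: "h \<in> X" "perp h b" "compl {b, a} = compl {b, h}"
        using orthogonalize[OF insert.prems(3) AX(2)] 3 by metis
      have Rag: "R \<subseteq> compl {a, g}"
        using A' RX by (auto simp: orthocompl_def pairwise_def R_def)
      then have Rb: "R \<subseteq> compl {b, a}" using g by (simp add: insert_commute)
      have bR: "b \<in> compl R"
        using Rb RX(1) insert.prems(3) perp_symD[of _ b] by (intro in_complI) (auto simp: orthocompl_def)
      have hR: "h \<in> compl R" using compl_pair_transfer RX Rb h by blast
      have hbR: "h \<in> compl (insert b R)" using hR h by (simp add: compl_insert)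
      have "pairwise perp (insert h (insert b R))"
        using pairwise_insertI[OF _ _ hbR] pairwise_insertI[OF _ pR bR] RX insert.prems by blast
      moreover have "card (insert h (insert b R)) = Suc (card A)"
        using compl_notin[OF hbR] compl_notin[OF bR] RX A'(6) A'R by simp
      moreover have "compl (insert h (insert b R)) = compl (insert a A)"
      proof -
        have "compl (insert h (insert b R)) = compl R \<inter> compl {b, h}"
          using compl_Un[of R "{b, h}"] by (simp add: insert_commute)
        also have "\<dots> = compl R \<inter> compl {a, g}"
          using h g by (simp add: insert_commute)
        also have "\<dots> = compl (insert a A')"
          using compl_Un[of R "{a, g}"] A'R by (simp add: insert_commute)
        finally show ?thesis using A' by (simp add: compl_insert)
      qed
      ultimately show ?thesis
        using insert.hyps insert.prems RX h
        by (intro exI[of _ "insert h (insert b R)"]) auto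
    qed
  qed
  then show ?thesis using that by blast
qed

text \<open>Exchange moves some \<open>b\<close> from \<open>B\<close> into \<open>A\<close>. After
  its removal from both sets, \<open>closure_drop\<close> puts the rest of \<open>B\<close> into the
  span of the rest of \<open>A\<close>.\<close>

lemma card_orthogonal_le:
  assumes "finite A" "A \<subseteq> X" "pairwise perp A" "finite B" "B \<subseteq> X" "pairwise perp B"
    "\<forall>b \<in> B. \<forall>x \<in> compl A. perp x b"
  shows "card B \<le> card A"
  using assms
proof (induction "card A" arbitrary: A B)
  case 0
  then have "\<forall>b\<in>B. perp b b" by (auto simp: orthocompl_def)
  then show ?case using perp_irreflD 0 by (metis card.empty equals0I le0 subsetD)
next
  case (Suc k)
  show ?case
  proof (cases "B = {}")
    case False
    then obtain b where b: "b \<in> B" by blast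
    have clb: "\<forall>x \<in> compl A. perp x b" and bX: "b \<in> X" using Suc b by auto
    obtain A' where A': "A' \<subseteq> X" "finite A'" "pairwise perp A'" "b \<in> A'" "card A' = card A"
        "compl A' = compl A"
      using exchange[OF Suc.prems(1-3) bX clb] .
    define R where "R = A' - {b}"
    have R: "R \<subseteq> X" "finite R" "pairwise perp R" "k = card R" "b \<in> compl R" "insert b R = A'"
      using A' bX Suc.hyps by (auto simp: R_def pairwise_def orthocompl_def)
    have "\<forall>c \<in> B - {b}. \<forall>x \<in> compl R. perp x c"
    proof (intro ballI)
      fix c x assume c: "c \<in> B - {b}" and x: "x \<in> compl R"
      have "perp c b" "c \<in> X" using c b Suc.prems by (auto simp: pairwise_def)
      moreover have "\<forall>x \<in> compl (insert b R). perp x c"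
        using c Suc.prems A' R by simp
      ultimately show "perp x c" using closure_drop[OF R(1,5)] x by blast
    qed
    moreover have "B - {b} \<subseteq> X" "pairwise perp (B - {b})"
      using Suc.prems by (auto simp: pairwise_def)
    ultimately have "card (B - {b}) \<le> card R"
      using Suc.hyps(1)[of R "B - {b}"] R Suc.prems(4) by blast
    then show ?thesis using b Suc.hyps(2) R(4) Suc.prems(4) by (simp add: card_Diff_singleton_if)
  qed simp
qed

text \<open>The last premise of \<open>card_orthogonal_le\<close> becomes vacuous, so one maximal
  orthogonal set determines the rank.\<close>

lemma rank_eqI:
  assumes "finite A" "A \<subseteq> X" "pairwise perp A" "compl A = {}"
  shows "orthoset_rank X perp = enat (card A)"
  unfolding orthoset_rank_def
proof (rule antisym)
  show "(SUP B \<in> {B. B \<subseteq> X \<and> pairwise perp B}. ecard B) \<le> enat (card A)"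
  proof (rule SUP_least)
    fix B assume B: "B \<in> {B. B \<subseteq> X \<and> pairwise perp B}"
    have "finite B"
    proof (rule ccontr)
      assume "infinite B"
      then obtain C where C: "C \<subseteq> B" "finite C" "card C = Suc (card A)"
        using infinite_arbitrarily_large by blast
      then have "C \<subseteq> X" "pairwise perp C" using B pairwise_subset by blast+
      then show False using card_orthogonal_le[OF assms(1-3) C(2)] assms(4) C by simp
    qed
    then show "ecard B \<le> enat (card A)"
      using card_orthogonal_le[OF assms(1-3), of B] assms(4) B by (auto simp: ecard_def)
  qed
  show "enat (card A) \<le> (SUP B \<in> {B. B \<subseteq> X \<and> pairwise perp B}. ecard B)"
    by (rule SUP_upper2[of A]) (use assms in \<open>auto simp: ecard_def\<close>)
qed

section \<open>Consequences of a finite rank\<close>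

lemma card_le_rank:
  assumes "orthoset_rank X perp = enat n" "A \<subseteq> X" "pairwise perp A"
  shows "finite A" "card A \<le> n"
proof -
  have "ecard A \<le> enat n"
    using assms by (metis (mono_tags, lifting) SUP_upper mem_Collect_eq orthoset_rank_def)
  then show "finite A" "card A \<le> n" by (auto simp: ecard_def split: if_splits)
qed

lemma rank_attained:
  assumes "orthoset_rank X perp = enat n"
  obtains B where "B \<subseteq> X" "finite B" "pairwise perp B" "card B = n"
proof -
  have "\<exists>B. B \<subseteq> X \<and> pairwise perp B \<and> card B \<ge> n"
  proof (rule ccontr)
    assume a: "\<not> ?thesis"
    then have "n > 0" by (metis empty_subsetI gr0I le0 pairwise_empty)
    have "orthoset_rank X perp \<le> enat (n - 1)"
      unfolding orthoset_rank_def
    proof (rule SUP_least)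
      fix B assume "B \<in> {B. B \<subseteq> X \<and> pairwise perp B}"
      then have "finite B" "card B < n" using a card_le_rank[OF assms] by (auto simp: not_le)
      then show "ecard B \<le> enat (n - 1)" by (auto simp: ecard_def)
    qed
    then show False using assms \<open>n > 0\<close> by simp
  qed
  then show ?thesis using that card_le_rank[OF assms] by (metis antisym)
qed

lemma extend_orthogonal:
  assumes "orthoset_rank X perp = enat n" "A \<subseteq> X" "pairwise perp A" "card A < n"
  obtains x where "x \<in> compl A"
proof -
  obtain B where "B \<subseteq> X" "finite B" "pairwise perp B" "card B = n"
    using rank_attained[OF assms(1)] .
  then have "compl A \<noteq> {}"
    using card_orthogonal_le[of A B] card_le_rank[OF assms(1-3)] assms(2-4) by auto
  then show ?thesis using that by blast
qed

text \<open>Any two lines of a plane meet. Once \<open>s\<close> is replaced by a \<open>g\<close>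
  orthogonal to \<open>r\<close>, the set \<open>R\<close> together with \<open>r\<close> and
  \<open>g\<close> is orthogonal with fewer than \<open>n\<close> elements, hence
  extendable.\<close>

lemma meet:
  assumes "orthoset_rank X perp = enat n" "R \<subseteq> X" "pairwise perp R" "card R + 2 < n"
    and r: "r \<in> compl R" and s: "s \<in> compl R"
  obtains x where "x \<in> compl R" "perp x r" "perp x s"
proof -
  have fin: "finite R" using card_le_rank assms by blast
  have X: "r \<in> X" "s \<in> X" using r s in_complD by auto
  have rR: "pairwise perp (insert r R)" using pairwise_insertI assms by blast
  show ?thesis
  proof (cases "r = s")
    case True
    obtain x where "x \<in> compl (insert r R)"
      by (rule extend_orthogonal[OF assms(1) _ rR])
        (use X assms fin in \<open>auto simp: card_insert_if\<close>)
    then show ?thesis using that True by (auto simp: compl_insert)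
  next
    case False
    obtain g where g: "g \<in> X" "perp g r" "compl {r, s} = compl {r, g}"
      using orthogonalize[OF X False] .
    have "R \<subseteq> compl {r, s}" using subset_compl_pairI r s assms(2) by blast
    then have "g \<in> compl R" using compl_pair_transfer g assms(2) by blast
    then have gR: "g \<in> compl (insert r R)" using g by (simp add: compl_insert)
    have "pairwise perp (insert g (insert r R))"
      using pairwise_insertI[OF _ rR gR] X assms(2) by blast
    then obtain x where x: "x \<in> compl (insert g (insert r R))"
      by (rule extend_orthogonal[OF assms(1), rotated])
        (use X g assms fin in \<open>auto simp: card_insert_if\<close>)
    then have "x \<in> compl {r, g}" by (auto simp: orthocompl_def)
    then have "x \<in> compl {r, s}" using g by simp
    then show ?thesis using that x by (auto simp: orthocompl_def)
  qed
qed

end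

section \<open>The triangle configuration\<close>

text \<open>A line of the plane orthogonal to \<open>R\<close> is represented by the point orthogonal to it: \<open>d\<close>, \<open>g\<close>, \<open>h\<close>, \<open>k\<close> stand
  for the lines \<open>pq\<close>, \<open>b3p\<close>, \<open>b2q\<close>, \<open>b1m\<close>. The point \<open>m\<close> is where the line \<open>pq\<close> meets the side \<open>b2b3\<close>,
  and \<open>r\<close> is the intersection of the cevians \<open>b3p\<close> and \<open>b2q\<close>; it lies on the third cevian if and
  only if it is orthogonal to \<open>k\<close>.\<close>

definition fano_configuration ::
    "nat \<Rightarrow> 'a set \<Rightarrow> ('a \<Rightarrow> 'a \<Rightarrow> bool) \<Rightarrow> 'a set \<Rightarrow> 'a \<Rightarrow> 'a \<Rightarrow> 'a \<Rightarrow> 'a \<Rightarrow> 'a \<Rightarrow> 'a \<Rightarrow> 'a \<Rightarrow> 'a \<Rightarrow> 'a \<Rightarrow> 'a \<Rightarrow> 'a \<Rightarrow> bool"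
  where
  "fano_configuration n X perp R b1 b2 b3 p q d m g h k r \<longleftrightarrow>
    R \<subseteq> X \<and> finite R \<and> pairwise perp R \<and> card R + 3 = n \<and>
    {b1, b2, b3, p, q, d, m, g, h, k, r} \<subseteq> orthocompl X perp R \<and>
    perp b1 b2 \<and> perp b1 b3 \<and> perp b2 b3 \<and>
    perp p b3 \<and> \<not> perp p b1 \<and> \<not> perp p b2 \<and>
    perp q b2 \<and> \<not> perp q b1 \<and> \<not> perp q b3 \<and>
    perp d p \<and> perp d q \<and> perp m b1 \<and> perp m d \<and>
    perp g b3 \<and> perp g p \<and> perp h b2 \<and> perp h q \<and>
    perp k b1 \<and> perp k m \<and> perp r g \<and> perp r h"

context linear_orthoset
begin

text \<open>Linearity gives obliqueness to \<open>e\<close> only; were \<open>p\<close> orthogonal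
  to \<open>f\<close>, then \<open>f\<close> would lie in \<open>compl {e, f}\<close> and be
  orthogonal to itself.\<close>

lemma third_point:
  assumes "e \<in> X" "f \<in> X" "perp e f"
  obtains p where "p \<in> X" "\<not> perp p e" "\<not> perp p f" "compl {e, f} = compl {e, p}"
proof -
  have ef: "e \<noteq> f" "perp f e" using assms perp_irreflD perp_symD by auto
  then obtain p where p: "p \<in> X" "\<not> perp p e" "compl {e, f} = compl {e, p}"
    using linear[OF assms(1,2)] by blast
  have "\<not> perp p f"
  proof
    assume "perp p f"
    then have "f \<in> compl {e, p}" using ef p perp_symD assms(2) by (simp add: orthocompl_def)
    then have "f \<in> compl {e, f}" using p by simp
    then show False using perp_irreflD assms(2) by (simp add: orthocompl_def)
  qed
  then show ?thesis using that p by blast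
qed

lemma fano_configuration_exists:
  assumes rank: "orthoset_rank X perp = enat n" and n: "n \<ge> 3"
  shows "\<exists>R b1 b2 b3 p q d m g h k r. fano_configuration n X perp R b1 b2 b3 p q d m g h k r"
proof -
  obtain B where B: "B \<subseteq> X" "finite B" "pairwise perp B" "card B = n"
    using rank_attained[OF rank] .
  obtain T where T: "T \<subseteq> B" "card T = 3"
    using obtain_subset_with_card_n n B(4) by metis
  then obtain b1 b2 b3 where bs: "T = {b1, b2, b3}" "b1 \<noteq> b2" "b1 \<noteq> b3" "b2 \<noteq> b3"
    by (metis card_3_iff)
  define R where "R = B - T"
  have R: "R \<subseteq> X" "finite R" "pairwise perp R"
    using B by (auto simp: R_def pairwise_def)
  have cR: "card R + 3 = n"
    using B T n by (simp add: R_def card_Diff_subset finite_subset)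
  have bX: "b1 \<in> X" "b2 \<in> X" "b3 \<in> X" using T bs B by auto
  have bb: "perp b1 b2" "perp b1 b3" "perp b2 b3"
    using T bs B by (auto simp: pairwise_def)
  have bR: "b1 \<in> compl R" "b2 \<in> compl R" "b3 \<in> compl R"
    using T bs B unfolding R_def pairwise_def by (auto intro!: in_complI)
  obtain p where p: "p \<in> X" "\<not> perp p b1" "\<not> perp p b2" "compl {b1, b2} = compl {b1, p}"
    using third_point bX bb by metis
  obtain q where q: "q \<in> X" "\<not> perp q b1" "\<not> perp q b3" "compl {b1, b3} = compl {b1, q}"
    using third_point bX bb by metis
  \<comment> \<open>\<open>p\<close> lies on the side \<open>b1 b2\<close> and so inherits
    orthogonality to \<open>b3\<close> and \<open>R\<close>.\<close>
  have "insert b3 R \<subseteq> compl {b1, b2}"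
    using subset_compl_pairI[OF R(1) bR(1,2)] perp_symD bX bb by (auto simp: orthocompl_def)
  then have "p \<in> compl (insert b3 R)"
    using compl_pair_transfer[of "insert b3 R" b1 b2 p] p R bX by simp
  then have pR: "p \<in> compl R" "perp p b3" by (auto simp: compl_insert)
  have "insert b2 R \<subseteq> compl {b1, b3}"
    using subset_compl_pairI[OF R(1) bR(1,3)] perp_symD bX bb by (auto simp: orthocompl_def)
  then have "q \<in> compl (insert b2 R)"
    using compl_pair_transfer[of "insert b2 R" b1 b3 q] q R bX by simp
  then have qR: "q \<in> compl R" "perp q b2" by (auto simp: compl_insert)
  \<comment> \<open>\<open>compl R\<close> is a plane, in which \<open>meet\<close> supplies all
    remaining points and lines.\<close>
  have "card R + 2 < n" using cR by simp
  note meetR = meet[OF rank R(1,3) this]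
  obtain d where d: "d \<in> compl R" "perp d p" "perp d q" using meetR pR(1) qR(1) .
  obtain m where m: "m \<in> compl R" "perp m b1" "perp m d" using meetR bR(1) d(1) .
  obtain g where g: "g \<in> compl R" "perp g b3" "perp g p" using meetR bR(3) pR(1) .
  obtain h where h: "h \<in> compl R" "perp h b2" "perp h q" using meetR bR(2) qR(1) .
  obtain k where k: "k \<in> compl R" "perp k b1" "perp k m" using meetR bR(1) m(1) .
  obtain r where r: "r \<in> compl R" "perp r g" "perp r h" using meetR g(1) h(1) .
  have "fano_configuration n X perp R b1 b2 b3 p q d m g h k r"
    unfolding fano_configuration_def
    using R cR bR bb p(2,3) q(2,3) pR qR d m g h k r by simp
  then show ?thesis by blast
qed

end

text \<open>Every clause relates given points only, so it is preserved although
  \<open>\<phi>\<close> need not be surjective.\<close>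

lemma fano_configuration_embedding:
  assumes emb: "orthoset_embedding X perp Y perp' \<phi>"
    and F: "fano_configuration n X perp R b1 b2 b3 p q d m g h k r"
  shows "fano_configuration n Y perp' (\<phi> ` R) (\<phi> b1) (\<phi> b2) (\<phi> b3) (\<phi> p) (\<phi> q)
    (\<phi> d) (\<phi> m) (\<phi> g) (\<phi> h) (\<phi> k) (\<phi> r)"
proof -
  have inj: "inj_on \<phi> X" and perp: "\<And>e f. \<lbrakk>e \<in> X; f \<in> X\<rbrakk> \<Longrightarrow> perp' (\<phi> e) (\<phi> f) \<longleftrightarrow> perp e f"
    and Y: "\<And>e. e \<in> X \<Longrightarrow> \<phi> e \<in> Y"
    using emb by (auto simp: orthoset_embedding_def)
  have R: "R \<subseteq> X" "finite R" "pairwise perp R" "card R + 3 = n"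
    and cR: "{b1, b2, b3, p, q, d, m, g, h, k, r} \<subseteq> orthocompl X perp R"
    using F by (simp_all add: fano_configuration_def)
  have X: "{b1, b2, b3, p, q, d, m, g, h, k, r} \<subseteq> X"
    using cR by (auto simp: orthocompl_def)
  have img: "\<phi> x \<in> orthocompl Y perp' (\<phi> ` R)" if "x \<in> orthocompl X perp R" for x
    using that R(1) perp Y by (auto simp: orthocompl_def)
  have "pairwise perp' (\<phi> ` R)"
    unfolding pairwise_image using R(1,3) perp by (auto simp: pairwise_def subset_iff)
  moreover have "card (\<phi> ` R) = card R" using inj R(1) by (meson card_image inj_on_subset)
  ultimately show ?thesis
    using F R X cR img Y perp unfolding fano_configuration_def by auto
qed

text \<open>Coordinates with respect to \<open>b1\<close>, \<open>b2\<close>, \<open>b3\<close>; those that do not occur are zero.\<close>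

lemma fano_algebra:
  fixes A1 A2 A3 :: "'k :: idom"
  assumes A: "A1 \<noteq> 0" "A2 \<noteq> 0" "A3 \<noteq> 0"
    and p: "p1 \<noteq> 0" "p2 \<noteq> 0" and q: "q1 \<noteq> 0" "q3 \<noteq> 0"
    and d: "A1*d1*p1 + A2*d2*p2 = 0" "A1*d1*q1 + A3*d3*q3 = 0" "d1 \<noteq> 0 \<or> d2 \<noteq> 0 \<or> d3 \<noteq> 0"
    and m: "A2*m2*d2 + A3*m3*d3 = 0" "m2 \<noteq> 0 \<or> m3 \<noteq> 0"
    and g: "A1*g1*p1 + A2*g2*p2 = 0" "g1 \<noteq> 0 \<or> g2 \<noteq> 0"
    and h: "A1*h1*q1 + A3*h3*q3 = 0" "h1 \<noteq> 0 \<or> h3 \<noteq> 0"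
    and k: "A2*k2*m2 + A3*k3*m3 = 0" "k2 \<noteq> 0 \<or> k3 \<noteq> 0"
    and r: "A1*r1*g1 + A2*r2*g2 = 0" "A1*r1*h1 + A3*r3*h3 = 0" "r1 \<noteq> 0 \<or> r2 \<noteq> 0 \<or> r3 \<noteq> 0"
  shows "A2*r2*k2 + A3*r3*k3 = 0 \<longleftrightarrow> (2::'k) = 0"
proof -
  \<comment> \<open>General position: none of the remaining coordinates vanishes, which permits the
    cancellations below.\<close>
  have dnz: "d1 \<noteq> 0" "d2 \<noteq> 0" "d3 \<noteq> 0" using d A p q by auto
  have mnz: "m2 \<noteq> 0" "m3 \<noteq> 0" using m A dnz by auto
  have knz: "k2 \<noteq> 0" "k3 \<noteq> 0" using k A mnz by auto
  have gnz: "g1 \<noteq> 0" "g2 \<noteq> 0" using g A p by auto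
  have hnz: "h1 \<noteq> 0" "h3 \<noteq> 0" using h A q by auto
  \<comment> \<open>Both \<open>g\<close> and \<open>d\<close> are orthogonal to \<open>p\<close>,
    so their first two coordinates are proportional; likewise \<open>h\<close> and \<open>d\<close>
    via \<open>q\<close>, \<open>k\<close> and \<open>d\<close> via \<open>m\<close>.\<close>
  have gd: "g1 * d2 = g2 * d1"
  proof -
    have "A2 * p2 * (g1 * d2 - g2 * d1) = 0" using d(1) g(1) by algebra
    then show ?thesis using A p by simp
  qed
  have hd: "h1 * d3 = h3 * d1"
  proof -
    have "A3 * q3 * (h1 * d3 - h3 * d1) = 0" using d(2) h(1) by algebra
    then show ?thesis using A q by simp
  qed
  have kd: "k2 * d3 = k3 * d2"
  proof -
    have "A3 * m3 * (k2 * d3 - k3 * d2) = 0" using m(1) k(1) by algebra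
    then show ?thesis using A mnz by simp
  qed
  \<comment> \<open>By proportionality, \<open>d\<close> replaces \<open>g\<close> and
    \<open>h\<close> in the equations for \<open>r\<close>.\<close>
  have rd2: "A1*r1*d1 + A2*r2*d2 = 0"
  proof -
    have "g1 * (A1*r1*d1 + A2*r2*d2) = 0" using r(1) gd by algebra
    then show ?thesis using gnz by simp
  qed
  have rd3: "A1*r1*d1 + A3*r3*d3 = 0"
  proof -
    have "h1 * (A1*r1*d1 + A3*r3*d3) = 0" using r(2) hd by algebra
    then show ?thesis using hnz by simp
  qed
  have "r1 \<noteq> 0" using r(3) rd2 rd3 A dnz by auto
  then have nz: "A1*r1*d1*k2 \<noteq> 0" using A dnz knz by simp
  \<comment> \<open>Both \<open>A2*r2*d2\<close> and \<open>A3*r3*d3\<close> equal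
    \<open>-A1*r1*d1\<close>; these equal contributions produce the factor 2.\<close>
  have "d2 * (A2*r2*k2 + A3*r3*k3) = - (2 * (A1*r1*d1*k2))"
    using rd2 rd3 kd by algebra
  then show ?thesis using nz dnz(2)
    by (metis mult_eq_0_iff neg_equal_0_iff_equal)
qed

section \<open>Orthosets of anisotropic forms\<close>

definition vectors :: "nat \<Rightarrow> (nat \<Rightarrow> 'k :: zero) set" where
  "vectors n = {x. (\<forall>i\<ge>n. x i = 0) \<and> (\<exists>i. x i \<noteq> 0)}"

definition form :: "nat \<Rightarrow> (nat \<Rightarrow> 'k) \<Rightarrow> (nat \<Rightarrow> 'k) \<Rightarrow> (nat \<Rightarrow> 'k) \<Rightarrow> 'k :: comm_ring_1" where
  "form n t x y = (\<Sum>i<n. t i * x i * y i)"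

definition polar :: "nat \<Rightarrow> (nat \<Rightarrow> 'k) \<Rightarrow> (nat \<Rightarrow> 'k :: comm_ring_1) \<Rightarrow> (nat \<Rightarrow> 'k) set" where
  "polar n t x = {z \<in> vectors n. form n t x z = 0}"

lemma form_commute: "form n t x y = form n t y x"
  by (simp add: form_def ac_simps)

lemma form_combine:
  "form n t (\<lambda>i. a * x i - b * y i) z = a * form n t x z - b * form n t y z"
  by (simp add: form_def sum_distrib_left algebra_simps sum_subtractf)

locale anisotropic_form =
  fixes n :: nat and t :: "nat \<Rightarrow> 'k :: idom"
  assumes anisotropic: "x \<in> vectors n \<Longrightarrow> form n t x x \<noteq> 0"

text \<open>The projective space of the form is coordinatised by an arbitrary type: a point is
  identified with the set of vectors orthogonal to it, so that no quotient by proportionality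
  is needed and scalars may range over a domain instead of its field of fractions.\<close>

locale form_orthoset = anisotropic_form n t for n :: nat and t :: "nat \<Rightarrow> 'k :: idom" +
  fixes Y :: "'b set" and vec :: "'b \<Rightarrow> nat \<Rightarrow> 'k"
  assumes vec: "y \<in> Y \<Longrightarrow> vec y \<in> vectors n"
    and vec_inj: "\<lbrakk>y \<in> Y; y' \<in> Y; polar n t (vec y) = polar n t (vec y')\<rbrakk> \<Longrightarrow> y = y'"
    and vec_surj: "x \<in> vectors n \<Longrightarrow> \<exists>y\<in>Y. polar n t (vec y) = polar n t x"
begin

definition perp :: "'b \<Rightarrow> 'b \<Rightarrow> bool" where
  "perp y y' \<longleftrightarrow> form n t (vec y) (vec y') = 0"

lemma perp_commute: "perp y y' \<longleftrightarrow> perp y' y"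
  by (simp add: perp_def form_commute)

text \<open>\<open>vec y\<close> need not be \<open>x\<close>; sharing its polar set suffices to
  replace it in every orthogonality test.\<close>

lemma point_of:
  assumes "x \<in> vectors n"
  obtains y where "y \<in> Y"
    "\<And>z. z \<in> vectors n \<Longrightarrow> form n t z (vec y) = 0 \<longleftrightarrow> form n t z x = 0"
    "\<And>z. z \<in> Y \<Longrightarrow> perp z y \<longleftrightarrow> form n t (vec z) x = 0"
proof -
  obtain y where y: "y \<in> Y" "polar n t (vec y) = polar n t x" using vec_surj assms by blast
  have *: "form n t z (vec y) = 0 \<longleftrightarrow> form n t z x = 0" if "z \<in> vectors n" for z
  proof -
    have "z \<in> polar n t (vec y) \<longleftrightarrow> z \<in> polar n t x" using y by simp
    then show ?thesis using that by (simp add: polar_def form_commute)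
  qed
  show ?thesis by (rule that[OF y(1)]) (use * vec in \<open>auto simp: perp_def\<close>)
qed

lemma linear_orthoset: "linear_orthoset Y perp"
proof
  show "symp_on Y perp" by (simp add: symp_on_def perp_commute)
  show "irreflp_on Y perp" using vec anisotropic by (auto simp: irreflp_on_def perp_def)
next
  fix e f assume e: "e \<in> Y" and f: "f \<in> Y" and ne: "e \<noteq> f"
  let ?a = "form n t (vec e) (vec e)" and ?b = "form n t (vec f) (vec e)"
  have a: "?a \<noteq> 0" using anisotropic vec e by blast
  have zero: "i \<ge> n \<Longrightarrow> vec e i = 0" "i \<ge> n \<Longrightarrow> vec f i = 0" for i
    using vec e f by (auto simp: vectors_def)
  show "\<exists>g\<in>Y. (perp f e \<longleftrightarrow> \<not> perp g e) \<and> orthocompl Y perp {e, f} = orthocompl Y perp {e, g}"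
  proof (cases "perp f e")
    case True
    then have b: "?b = 0" by (simp add: perp_def)
    \<comment> \<open>This is \<open>e + f\<close>, shaped for \<open>form_combine\<close>. Its
      product with \<open>e\<close> is that of \<open>e\<close> with itself, nonzero in any
      characteristic.\<close>
    define x where "x = (\<lambda>i. 1 * vec f i - (-1) * vec e i)"
    have form_x: "form n t z x = form n t z (vec f) + form n t z (vec e)" for z
      unfolding form_commute[of n t z] x_def form_combine by simp
    have ex: "form n t (vec e) x \<noteq> 0" using a b by (simp add: form_x form_commute[of n t "vec e" "vec f"])
    then have "x \<in> vectors n"
      using zero by (auto simp: vectors_def form_def x_def intro!: sum.neutral)
    then obtain g where g: "g \<in> Y" "\<And>z. z \<in> Y \<Longrightarrow> perp z g \<longleftrightarrow> form n t (vec z) x = 0"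
      using point_of by metis
    have "\<not> perp e g" using g(2)[OF e] ex by simp
    moreover have "orthocompl Y perp {e, f} = orthocompl Y perp {e, g}"
      unfolding orthocompl_def using g(2) by (auto simp: form_x perp_def)
    ultimately show ?thesis using g True perp_commute by blast
  next
    case False
    then have b: "?b \<noteq> 0" by (simp add: perp_def)
    \<comment> \<open>Gram-Schmidt with denominators cleared. If this were zero, \<open>e\<close>
      and \<open>f\<close> would be proportional and hence the same point.\<close>
    define x where "x = (\<lambda>i. ?a * vec f i - ?b * vec e i)"
    have form_x: "form n t z x = ?a * form n t z (vec f) - ?b * form n t z (vec e)" for z
      unfolding form_commute[of n t z] x_def form_combine by simp
    have "x \<in> vectors n"
    proof (rule ccontr)
      assume "x \<notin> vectors n"
      then have "x = (\<lambda>i. 0)" using zero by (auto simp: vectors_def x_def)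
      then have eq: "?a * form n t z (vec f) = ?b * form n t z (vec e)" for z
        using form_x[of z] by (simp add: form_def)
      have "form n t z (vec f) = 0 \<longleftrightarrow> form n t z (vec e) = 0" for z
        using eq[of z] a b by (metis mult_eq_0_iff)
      then have "polar n t (vec e) = polar n t (vec f)"
        unfolding polar_def form_commute[of n t "vec e"] form_commute[of n t "vec f"] by simp
      then show False using vec_inj e f ne by blast
    qed
    then obtain g where g: "g \<in> Y" "\<And>z. z \<in> Y \<Longrightarrow> perp z g \<longleftrightarrow> form n t (vec z) x = 0"
      using point_of by metis
    have "perp e g" using g(2)[OF e] form_x[of "vec e"] form_commute[of n t "vec e" "vec f"]
      by (simp add: mult.commute)
    moreover have "orthocompl Y perp {e, f} = orthocompl Y perp {e, g}"
      unfolding orthocompl_def using g(2) a by (auto simp: form_x perp_def)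
    ultimately show ?thesis using g False perp_commute by blast
  qed
qed

sublocale linear_orthoset Y perp by (rule linear_orthoset)

text \<open>The points of the unit vectors form a maximal orthogonal set: orthogonality to the
  \<open>i\<close>-th one means that coordinate \<open>i\<close> vanishes.\<close>

lemma rank: "orthoset_rank Y perp = enat n"
proof -
  define \<delta> :: "nat \<Rightarrow> nat \<Rightarrow> 'k" where "\<delta> i = (\<lambda>j. if j = i then 1 else 0)" for i
  have \<delta>: "\<delta> i \<in> vectors n" if "i < n" for i using that by (auto simp: vectors_def \<delta>_def)
  have form_\<delta>: "form n t x (\<delta> i) = t i * x i" if "i < n" for x i
  proof -
    have "form n t x (\<delta> i) = (\<Sum>j<n. if i = j then t j * x j else 0)"
      unfolding form_def \<delta>_def by (rule sum.cong) auto
    then show ?thesis using that by simp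
  qed
  have t: "t i \<noteq> 0" if "i < n" for i
    using anisotropic[OF \<delta>[OF that]] form_\<delta>[OF that] by auto
  have "\<exists>y. y \<in> Y \<and> (\<forall>z\<in>vectors n. form n t z (vec y) = 0 \<longleftrightarrow> form n t z (\<delta> i) = 0)"
    if "i < n" for i
    using point_of[OF \<delta>[OF that]] by metis
  then obtain y where y: "\<And>i. i < n \<Longrightarrow> y i \<in> Y"
      "\<And>i z. i < n \<Longrightarrow> z \<in> vectors n \<Longrightarrow> form n t z (vec (y i)) = 0 \<longleftrightarrow> form n t z (\<delta> i) = 0"
    by metis
  have coord: "form n t z (vec (y i)) = 0 \<longleftrightarrow> z i = 0" if "i < n" "z \<in> vectors n" for z i
    using y(2)[OF that] form_\<delta>[OF that(1)] t[OF that(1)] by simp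
  have yy: "perp (y i) (y j)" if "i < n" "j < n" "i \<noteq> j" for i j
  proof -
    have "form n t (\<delta> j) (vec (y i)) = 0" using coord[OF that(1) \<delta>[OF that(2)]] that by (simp add: \<delta>_def)
    then have "vec (y i) j = 0" using that t form_\<delta>[OF that(2)] form_commute
      by (metis mult_eq_0_iff)
    then show ?thesis using coord[OF that(2) vec[OF y(1)[OF that(1)]]] by (simp add: perp_def)
  qed
  have "inj_on y {..<n}"
    using yy y(1) perp_irreflD by (metis inj_onI lessThan_iff)
  then have "card (y ` {..<n}) = n" by (simp add: card_image)
  moreover have "orthocompl Y perp (y ` {..<n}) = {}"
  proof (rule ccontr)
    assume "\<not> ?thesis"
    then obtain z where z: "z \<in> Y" "\<forall>i<n. perp z (y i)" by (auto simp: orthocompl_def)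
    then have "\<forall>i<n. vec z i = 0" using coord vec by (simp add: perp_def)
    then show False using vec[OF z(1)] by (auto simp: vectors_def not_le[symmetric])
  qed
  moreover have "pairwise perp (y ` {..<n})" using yy by (auto simp: pairwise_def)
  ultimately show ?thesis using rank_eqI[of "y ` {..<n}"] y(1) by auto
qed

text \<open>Products with \<open>b1\<close>, \<open>b2\<close>, \<open>b3\<close> serve as
  coordinates on \<open>compl R\<close>, in which the form is diagonal up to a nonzero
  factor.\<close>

lemma fano_configuration_iff:
  assumes F: "fano_configuration n Y perp R b1 b2 b3 p q d m g h k r"
  shows "perp r k \<longleftrightarrow> (2 :: 'k) = 0"
proof -
  let ?f = "\<lambda>x y. form n t (vec x) (vec y)"
  have R: "R \<subseteq> Y" "finite R" "pairwise perp R" "card R + 3 = n"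
    and cR: "{b1, b2, b3, p, q, d, m, g, h, k, r} \<subseteq> compl R"
    and perps: "perp b1 b2" "perp b1 b3" "perp b2 b3"
      "perp p b3" "\<not> perp p b1" "\<not> perp p b2"
      "perp q b2" "\<not> perp q b1" "\<not> perp q b3"
      "perp d p" "perp d q" "perp m b1" "perp m d"
      "perp g b3" "perp g p" "perp h b2" "perp h q"
      "perp k b1" "perp k m" "perp r g" "perp r h"
    using F by (simp_all add: fano_configuration_def)
  have bR: "b1 \<in> compl R" "b2 \<in> compl R" "b3 \<in> compl R" using cR by auto
  then have bY: "b1 \<in> Y" "b2 \<in> Y" "b3 \<in> Y" by (auto simp: orthocompl_def)
  define a1 a2 a3 where "a1 = ?f b1 b1" and "a2 = ?f b2 b2" and "a3 = ?f b3 b3"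
  have a: "a1 \<noteq> 0" "a2 \<noteq> 0" "a3 \<noteq> 0"
    using anisotropic vec bY by (auto simp: a1_def a2_def a3_def)
  have f12: "?f b1 b2 = 0" "?f b2 b1 = 0" "?f b1 b3 = 0" "?f b3 b1 = 0" "?f b2 b3 = 0" "?f b3 b2 = 0"
    using perps perp_commute by (auto simp: perp_def)
  define B where "B = insert b1 (insert b2 (insert b3 R))"
  have b2c: "b2 \<in> compl (insert b3 R)" and b1c: "b1 \<in> compl (insert b2 (insert b3 R))"
    using bR perps by (auto simp: compl_insert)
  have pB: "pairwise perp B" "B \<subseteq> Y"
    using pairwise_insertI[OF _ _ b1c] pairwise_insertI[OF _ _ b2c] pairwise_insertI[OF _ _ bR(3)]
      R bY by (auto simp: B_def)
  have cB: "card B = n"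
    using compl_notin[OF b1c] compl_notin[OF b2c] compl_notin[OF bR(3)] R by (simp add: B_def)
  have max: "compl B = {}"
  proof (rule ccontr)
    assume "compl B \<noteq> {}"
    then obtain z where z: "z \<in> compl B" by blast
    then have "card (insert z B) \<le> n"
      using card_le_rank[OF rank, of "insert z B"] pairwise_insertI[OF pB(2,1)] pB(2)
      by (auto simp: orthocompl_def)
    then show False using compl_notin[OF z] cB card_le_rank[OF rank pB(2,1)] by simp
  qed
  \<comment> \<open>Expansion in an orthogonal basis, multiplied by \<open>a1 * a2 * a3\<close>
    because scalars need not have inverses.\<close>
  have expand: "a1 * a2 * a3 * ?f x y =
      a2 * a3 * ?f x b1 * ?f y b1 + a1 * a3 * ?f x b2 * ?f y b2 + a1 * a2 * ?f x b3 * ?f y b3"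
    if x: "x \<in> compl R" for x y
  proof -
    \<comment> \<open>\<open>u\<close> is the error of the expansion of \<open>x\<close>. It is
      orthogonal to \<open>B\<close>, so if nonzero it would yield a point of the empty
      \<open>compl B\<close>.\<close>
    define u where "u = (\<lambda>i. 1 * (\<lambda>i. 1 * (\<lambda>i. a1 * a2 * a3 * vec x i - a2 * a3 * ?f x b1 * vec b1 i) i
      - a1 * a3 * ?f x b2 * vec b2 i) i - a1 * a2 * ?f x b3 * vec b3 i)"
    have form_u: "form n t u z = a1 * a2 * a3 * form n t (vec x) z - a2 * a3 * ?f x b1 * form n t (vec b1) z
      - a1 * a3 * ?f x b2 * form n t (vec b2) z - a1 * a2 * ?f x b3 * form n t (vec b3) z" for z
      unfolding u_def form_combine by simp
    have "u \<notin> vectors n"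
    proof
      assume "u \<in> vectors n"
      then obtain z where z: "z \<in> Y" "\<And>y. y \<in> Y \<Longrightarrow> perp y z \<longleftrightarrow> form n t (vec y) u = 0"
        using point_of by metis
      have "perp y z" if "y \<in> B" for y
      proof -
        have "y \<in> Y" using that pB by blast
        have "form n t u (vec y) = 0"
        proof (cases "y \<in> R")
          case True
          then have "?f x y = 0" "?f b1 y = 0" "?f b2 y = 0" "?f b3 y = 0"
            using x bR by (auto simp: orthocompl_def perp_def)
          then show ?thesis by (simp add: form_u)
        next
          case False
          then have "y = b1 \<or> y = b2 \<or> y = b3" using that by (auto simp: B_def)
          then show ?thesis
            using f12 by (auto simp: form_u a1_def a2_def a3_def)
        qed
        then show ?thesis using z(2) \<open>y \<in> Y\<close> form_commute by metis
      qed
      then have "z \<in> compl B" using z(1) perp_commute by (auto simp: orthocompl_def)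
      then show False using max by blast
    qed
    moreover have "x \<in> Y" using x by (auto simp: orthocompl_def)
    ultimately have "u = (\<lambda>i. 0)"
      using vec bY by (auto simp: vectors_def u_def)
    then have "form n t u (vec y) = 0" by (simp add: form_def)
    then show ?thesis by (simp add: form_u form_commute[of _ _ "vec y"] algebra_simps)
  qed
  define A1 A2 A3 where "A1 = a2 * a3" and "A2 = a1 * a3" and "A3 = a1 * a2"
  have A: "A1 \<noteq> 0" "A2 \<noteq> 0" "A3 \<noteq> 0" using a by (auto simp: A1_def A2_def A3_def)
  have perp_iff: "perp x y \<longleftrightarrow>
      A1 * ?f x b1 * ?f y b1 + A2 * ?f x b2 * ?f y b2 + A3 * ?f x b3 * ?f y b3 = 0"
    if "x \<in> compl R" for x y
    using expand[OF that, of y] a unfolding perp_def A1_def A2_def A3_def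
    by (metis mult_eq_0_iff)
  have nonzero: "?f x b1 \<noteq> 0 \<or> ?f x b2 \<noteq> 0 \<or> ?f x b3 \<noteq> 0" if "x \<in> compl R" for x
    using perp_iff[OF that, of x] that perp_irreflD by (auto simp: orthocompl_def)
  have zeros: "?f p b3 = 0" "?f q b2 = 0" "?f m b1 = 0" "?f g b3 = 0" "?f h b2 = 0" "?f k b1 = 0"
    and nz: "?f p b1 \<noteq> 0" "?f p b2 \<noteq> 0" "?f q b1 \<noteq> 0" "?f q b3 \<noteq> 0"
    using perps by (simp_all add: perp_def)
  have C: "d \<in> compl R" "m \<in> compl R" "g \<in> compl R" "h \<in> compl R" "k \<in> compl R" "r \<in> compl R"
    using cR by auto
  have "A2 * ?f r b2 * ?f k b2 + A3 * ?f r b3 * ?f k b3 = 0 \<longleftrightarrow> (2 :: 'k) = 0"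
    by (rule fano_algebra[OF A nz, of "?f d b1" "?f d b2" "?f d b3" "?f m b2" "?f m b3"
          "?f g b1" "?f g b2" "?f h b1" "?f h b3" "?f k b2" "?f k b3" "?f r b1"])
      (use nonzero C perps(10,11,13,15,17,19,20,21) zeros perp_iff in \<open>force+\<close>)
  then show ?thesis using perp_iff[OF C(6)] zeros by simp
qed

end

text \<open>Countably many vectors have countably many polar sets, which can be coded in any
  infinite type; \<open>inv_into\<close> picks a vector for each code.\<close>

lemma form_orthoset_exists:
  fixes t :: "nat \<Rightarrow> 'k :: idom"
  assumes "anisotropic_form n t" and countable: "countable (UNIV :: 'k set)"
  shows "\<exists>(Y :: 'b :: infinite set) vec. form_orthoset n t Y vec"
proof -
  have "vectors n \<subseteq> (\<lambda>l i. if i < n then l ! i else (0 :: 'k)) ` lists UNIV"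
  proof
    fix x :: "nat \<Rightarrow> 'k" assume "x \<in> vectors n"
    then have "x = (\<lambda>i. if i < n then map x [0..<n] ! i else 0)"
      by (auto simp: vectors_def)
    then show "x \<in> (\<lambda>l i. if i < n then l ! i else (0 :: 'k)) ` lists UNIV" by blast
  qed
  then have "countable (vectors n :: (nat \<Rightarrow> 'k) set)"
    using countable by (meson countable_image countable_lists countable_subset)
  then have "countable (polar n t ` vectors n)" by simp
  then obtain c :: "(nat \<Rightarrow> 'k) set \<Rightarrow> nat" where c: "inj_on c (polar n t ` vectors n)"
    by (rule countableE)
  obtain e :: "nat \<Rightarrow> 'b" where e: "inj e"
    using infinite_countable_subset[OF infinite_UNIV] by blast
  define code where "code x = e (c (polar n t x))" for x
  have code: "code x = code y \<longleftrightarrow> polar n t x = polar n t y" if "x \<in> vectors n" "y \<in> vectors n" for x y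
    using that c e by (auto simp: code_def inj_on_def)
  have inv: "inv_into (vectors n) code y \<in> vectors n" "code (inv_into (vectors n) code y) = y"
    if "y \<in> code ` vectors n" for y
    using that by (auto simp: inv_into_into f_inv_into_f)
  have "form_orthoset n t (code ` vectors n) (inv_into (vectors n) code)"
    unfolding form_orthoset_def form_orthoset_axioms_def
    using assms(1) inv code by (metis imageI)
  then show ?thesis by blast
qed

section \<open>Forms over the integers and in characteristic 2\<close>

lemma anisotropic_form_int: "anisotropic_form n (\<lambda>_. 1 :: int)"
proof
  fix x :: "nat \<Rightarrow> int" assume "x \<in> vectors n"
  then obtain i where i: "i < n" "x i \<noteq> 0" by (auto simp: vectors_def not_le[symmetric])
  have "0 < x i * x i" using i by (simp add: zero_less_mult_iff) linarith
  also have "\<dots> \<le> (\<Sum>i<n. x i * x i)" using i by (intro member_le_sum) auto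
  finally show "form n (\<lambda>_. 1) x x \<noteq> 0" by (simp add: form_def)
qed

lemma countable_poly_mapping:
  assumes "countable (UNIV :: 'a set)" "countable (UNIV :: 'b :: zero set)"
  shows "countable (UNIV :: ('a \<Rightarrow>\<^sub>0 'b) set)"
proof -
  define graph where "graph x = (\<lambda>k. (k, Poly_Mapping.lookup x k)) ` Poly_Mapping.keys x" for x :: "'a \<Rightarrow>\<^sub>0 'b"
  have "inj graph"
  proof (rule injI)
    fix x y :: "'a \<Rightarrow>\<^sub>0 'b" assume eq: "graph x = graph y"
    have *: "Poly_Mapping.lookup z k = v \<and> v \<noteq> 0 \<longleftrightarrow> (k, v) \<in> graph z" for z :: "'a \<Rightarrow>\<^sub>0 'b" and k and v :: 'b
      by (auto simp: graph_def in_keys_iff)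
    show "x = y" using * eq by (intro poly_mapping_eqI) metis
  qed
  moreover have "countable (range graph)"
  proof (rule countable_subset)
    show "range graph \<subseteq> {A. finite A \<and> A \<subseteq> UNIV}" by (auto simp: graph_def)
    show "countable {A :: ('a \<times> 'b) set. finite A \<and> A \<subseteq> UNIV}"
      by (rule countable_Collect_finite_subset) (use assms countable_SIGMA[of UNIV "\<lambda>_. UNIV"] in simp)
  qed
  ultimately show ?thesis by (simp add: countable_image_inj_eq)
qed

section \<open>Polynomials over the field with two elements\<close>

lemma UNIV_bit: "(UNIV :: bit set) = {0, 1}"
  by (auto intro: bit.exhaust)

text \<open>The inner maps are exponent vectors of monomials in countably many variables.\<close>

type_synonym bit_polynomial = "(nat \<Rightarrow>\<^sub>0 nat) \<Rightarrow>\<^sub>0 bit"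

definition variable :: "nat \<Rightarrow> bit_polynomial" where
  "variable i = Poly_Mapping.single (Poly_Mapping.single i 1) 1"

lemma two_bit_polynomial: "(2 :: bit_polynomial) = 0"
proof -
  have "(2 :: bit_polynomial) = Poly_Mapping.single 0 2"
    by (simp flip: single_numeral)
  then show ?thesis by simp
qed

text \<open>Squaring is additive in characteristic 2, so \<open>variable i * x * x\<close> has only
  monomials that are \<open>variable i\<close> times a square. The induction adds one monomial at a
  time.\<close>

lemma lookup_variable_square:
  "Poly_Mapping.lookup (variable i * x * x) (Poly_Mapping.single j 1 + m + m) = (if i = j then Poly_Mapping.lookup x m else 0)"
proof (induction x rule: update_induct)
  case const
  show ?case by (simp add: lookup_zero)
next
  case (update f a b)
  have b: "b = 1" using update.hyps(2) by (cases b) auto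
  have "Poly_Mapping.lookup (Poly_Mapping.update a b f) k = Poly_Mapping.lookup (f + Poly_Mapping.single a 1) k" for k
    using update.hyps(1) b by (simp add: lookup_update lookup_add lookup_single in_keys_iff when_def) auto
  then have upd: "Poly_Mapping.update a b f = f + Poly_Mapping.single a 1"
    by (rule poly_mapping_eqI)
  have "variable i * (f + Poly_Mapping.single a 1) * (f + Poly_Mapping.single a 1) =
      variable i * f * f + variable i * Poly_Mapping.single a 1 * Poly_Mapping.single a 1
      + 2 * (variable i * f * Poly_Mapping.single a 1)"
    by (simp add: algebra_simps)
  also have "\<dots> = variable i * f * f + Poly_Mapping.single (Poly_Mapping.single i 1 + a + a) 1"
    by (simp add: two_bit_polynomial variable_def mult_single)
  finally have eq: "variable i * (f + Poly_Mapping.single a 1) * (f + Poly_Mapping.single a 1) =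
      variable i * f * f + Poly_Mapping.single (Poly_Mapping.single i 1 + a + a) 1" .
  have "Poly_Mapping.single i 1 + a + a = Poly_Mapping.single j 1 + m + m \<longleftrightarrow> i = j \<and> a = m"
  proof
    assume e: "Poly_Mapping.single i 1 + a + a = Poly_Mapping.single j 1 + m + m"
    have l: "(if i = l then 1 else 0) + Poly_Mapping.lookup a l + Poly_Mapping.lookup a l = (if j = l then 1 else 0) + Poly_Mapping.lookup m l + Poly_Mapping.lookup m l" for l
      using arg_cong[OF e, of "\<lambda>x. Poly_Mapping.lookup x l"]
      by (auto simp: lookup_add lookup_single when_def split: if_splits)
    \<comment> \<open>The exponent of \<open>i\<close> is odd on the left, while on the right only
      that of \<open>j\<close> is odd.\<close>
    have "i = j" using l[of i] by (simp split: if_splits) presburger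
    moreover have "a = m"
    proof (rule poly_mapping_eqI)
      show "Poly_Mapping.lookup a l = Poly_Mapping.lookup m l" for l
        using l[of l] \<open>i = j\<close> by simp
    qed
    ultimately show "i = j \<and> a = m" by simp
  qed simp
  then show ?case
    unfolding upd eq by (simp add: lookup_add update.IH lookup_single when_def del: One_nat_def)
qed

text \<open>The summands share no monomials, so nothing cancels: every coefficient of every
  \<open>x j\<close> reappears in the value of the form.\<close>

lemma anisotropic_form_variable: "anisotropic_form n variable"
proof
  fix x :: "nat \<Rightarrow> bit_polynomial" assume x: "x \<in> vectors n"
  show "form n variable x x \<noteq> 0"
  proof
    assume 0: "form n variable x x = 0"
    have "Poly_Mapping.lookup (x j) m = 0" if "j < n" for j and m :: "nat \<Rightarrow>\<^sub>0 nat"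
    proof -
      have "0 = Poly_Mapping.lookup (form n variable x x) (Poly_Mapping.single j 1 + m + m)"
        by (simp add: 0)
      also have "\<dots> = (\<Sum>i<n. if i = j then Poly_Mapping.lookup (x i) m else 0)"
        by (simp add: form_def lookup_sum lookup_variable_square del: One_nat_def)
      also have "\<dots> = Poly_Mapping.lookup (x j) m" using that by simp
      finally show ?thesis by simp
    qed
    then have "x j = 0" if "j < n" for j using that by (intro poly_mapping_eqI) simp
    then show False using x by (auto simp: vectors_def not_le[symmetric])
  qed
qed

theorem mainTheorem7:
  fixes n :: nat
  assumes "n \<ge> 4"
  shows "\<not> (\<exists>(X :: 'a set) (perp :: 'a \<Rightarrow> 'a \<Rightarrow> bool).
    linear_orthoset X perp \<and> orthoset_rank X perp = enat n \<and>
    (\<forall>(Y :: 'b :: infinite set) (perp' :: 'b \<Rightarrow> 'b \<Rightarrow> bool).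
      linear_orthoset Y perp' \<and> orthoset_rank Y perp' = enat n \<longrightarrow>
      orthoset_embeds X perp Y perp'))"
proof clarify
  fix X :: "'a set" and perp :: "'a \<Rightarrow> 'a \<Rightarrow> bool"
  assume X: "linear_orthoset X perp" "orthoset_rank X perp = enat n"
    and universal: "\<forall>(Y :: 'b set) perp'. linear_orthoset Y perp' \<and> orthoset_rank Y perp' = enat n \<longrightarrow>
      orthoset_embeds X perp Y perp'"
  obtain R b1 b2 b3 p q d m g h k r where
    F: "fano_configuration n X perp R b1 b2 b3 p q d m g h k r"
    using linear_orthoset.fano_configuration_exists[OF X] assms by auto
  have rk: "r \<in> X" "k \<in> X" using F by (auto simp: fano_configuration_def orthocompl_def)
  \<comment> \<open>The configuration is fixed in \<open>X\<close> before \<open>Y\<close> is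
    chosen, so the same \<open>perp r k\<close> must decide whether 2 vanishes in each of these
    domains.\<close>
  have key: "perp r k \<longleftrightarrow> (2 :: 'k) = 0"
    if t: "anisotropic_form n t" "countable (UNIV :: 'k set)" for t :: "nat \<Rightarrow> 'k :: idom"
  proof -
    obtain Y :: "'b set" and vec where "form_orthoset n t Y vec"
      using form_orthoset_exists[OF t] by blast
    then interpret form_orthoset n t Y vec .
    obtain \<phi> where emb: "orthoset_embedding X perp Y local.perp \<phi>"
      using universal linear_orthoset rank by (auto simp: orthoset_embeds_def)
    have "perp r k \<longleftrightarrow> local.perp (\<phi> r) (\<phi> k)"
      using emb rk by (simp add: orthoset_embedding_def)
    then show ?thesis
      using fano_configuration_iff[OF fano_configuration_embedding[OF emb F]] by simp
  qed
  have "\<not> perp r k" using key[OF anisotropic_form_int] by simp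
  moreover have "countable (UNIV :: bit_polynomial set)"
    by (intro countable_poly_mapping countableI_type countable_finite) (simp add: UNIV_bit)
  then have "perp r k"
    using key[OF anisotropic_form_variable] two_bit_polynomial by blast
  ultimately show False by simp
qed

end
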